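(* Let $T$ be an $n$-tournament with $n\geq 3$, and let $s(T)$ denote its simplicity index. For every integer $k$ the following statements hold: 1. if $n=4k+2$, then $s(T)\leq 2k$; 2. if $n=4k+1$, then $s(T)\leq 2k-1$; 3. if $n=4k$, then $s(T)\leq 2k-2$.
   Context: A tournament $T=(V,A)$ consists of a finite vertex set $V$ and a set $A$ of ordered pairs of distinct vertices (arcs) such that for all $x\neq y\in V$, $(x,y)\in A$ if and only if $(y,x)\notin A$. One writes $x\rightarrow y$ ($x$ dominates $y$) when $(x,y)\in A$. An $n$-tournament is a tournament with $n$ vertices. A module of $T$ is a subset $M\subseteq V$ such that for every $x\in V\setminus M$, either $m\rightarrow x$ for all $m\in M$, or $x\rightarrow m$ for all $m\in M$. The trivial modules are $\emptyset$, the singletons and $V$. An $n$-tournament is simple if $n\geq 3$ and all its modules are trivial. For an $n$-tournament $T$ with $n\geq 3$, the simplicity index $s(T)$ is the minimum number of arcs of $T$ whose reversal yields a non-simple tournament (so $s(T)=0$ if $T$ is not simple). *)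

theory Defs
  imports Main "Graph_Theory.Pair_Digraph"
begin

text \<open>
  \<^const>\<open>pair_digraph\<close> provides finiteness, arcs between vertices, and absence of loops;
  its vertex set may be empty.
\<close>

definition tournament :: "'a pair_pre_digraph \<Rightarrow> bool" where
  "tournament T \<longleftrightarrow> pair_digraph T \<and>
     (\<forall>x\<in>pverts T. \<forall>y\<in>pverts T. x \<noteq> y \<longrightarrow> ((x, y) \<in> parcs T \<longleftrightarrow> (y, x) \<notin> parcs T))"

definition is_module :: "'a pair_pre_digraph \<Rightarrow> 'a set \<Rightarrow> bool" where
  "is_module T M \<longleftrightarrow> M \<subseteq> pverts T \<and>
     (\<forall>x\<in>pverts T - M. (\<forall>m\<in>M. (m, x) \<in> parcs T) \<or> (\<forall>m\<in>M. (x, m) \<in> parcs T))"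

definition trivial_module :: "'a pair_pre_digraph \<Rightarrow> 'a set \<Rightarrow> bool" where
  "trivial_module T M \<longleftrightarrow> M = {} \<or> (\<exists>x\<in>pverts T. M = {x}) \<or> M = pverts T"

definition simple_tournament :: "'a pair_pre_digraph \<Rightarrow> bool" where
  "simple_tournament T \<longleftrightarrow> tournament T \<and> card (pverts T) \<ge> 3 \<and>
     (\<forall>M. is_module T M \<longrightarrow> trivial_module T M)"

definition reverse_arcs :: "'a pair_pre_digraph \<Rightarrow> ('a \<times> 'a) set \<Rightarrow> 'a pair_pre_digraph" where
  "reverse_arcs T B = \<lparr> pverts = pverts T, parcs = (parcs T - B) \<union> B\<inverse> \<rparr>"

text \<open>
  The set of admissible sizes is nonempty when the tournament has at least three vertices
  (lemma \<open>ex_non_simple_reversal\<close>), so the least element is a genuine minimum there;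
  for smaller tournaments the value carries no meaning.
\<close>

definition simplicity_index :: "'a pair_pre_digraph \<Rightarrow> nat" where
  "simplicity_index T =
     (LEAST j. \<exists>B. B \<subseteq> parcs T \<and> card B = j \<and>
        tournament (reverse_arcs T B) \<and> \<not> simple_tournament (reverse_arcs T B))"

lemma pair_digraph_iff:
  "pair_digraph T \<longleftrightarrow> finite (pverts T) \<and> parcs T \<subseteq> pverts T \<times> pverts T \<and>
     (\<forall>x. (x, x) \<notin> parcs T)"
  (is "_ \<longleftrightarrow> ?R")
proof
  assume "pair_digraph T"
  then interpret pair_digraph T .
  have "parcs T \<subseteq> pverts T \<times> pverts T"
    using in_arcsD1 in_arcsD2 by (intro subrelI) blast
  moreover have "(x, x) \<notin> parcs T" for x
    using no_loops'[of x x] by blast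
  ultimately show ?R by simp
next
  assume r: ?R
  then have f: "finite (parcs T)"
    by (meson finite_SigmaI finite_subset)
  show "pair_digraph T"
  proof
    fix e assume e: "e \<in> parcs T"
    show "fst e \<in> pverts T" "snd e \<in> pverts T" using r e by auto
    show "fst e \<noteq> snd e" using r e by (metis prod.collapse)
  qed (use r f in simp_all)
qed

lemma tournament_reverse_arcs:
  assumes "tournament T" "B \<subseteq> parcs T"
  shows "tournament (reverse_arcs T B)"
proof -
  have fin: "finite (pverts T)" and sub: "parcs T \<subseteq> pverts T \<times> pverts T"
    and irr: "\<forall>x. (x, x) \<notin> parcs T"
    using assms(1) unfolding tournament_def pair_digraph_iff by blast+
  have tot: "(x, y) \<in> parcs T \<longleftrightarrow> (y, x) \<notin> parcs T"
    if "x \<in> pverts T" "y \<in> pverts T" "x \<noteq> y" for x y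
    using assms(1) that unfolding tournament_def by blast
  have "(x, y) \<in> (parcs T - B) \<union> B\<inverse> \<longleftrightarrow> (y, x) \<notin> (parcs T - B) \<union> B\<inverse>"
    if "x \<in> pverts T" "y \<in> pverts T" "x \<noteq> y" for x y
    using tot[OF that] assms(2) by blast
  moreover have "(parcs T - B) \<union> B\<inverse> \<subseteq> pverts T \<times> pverts T"
    using sub assms(2) by blast
  moreover have "\<forall>x. (x, x) \<notin> (parcs T - B) \<union> B\<inverse>"
    using irr assms(2) by blast
  ultimately show ?thesis
    unfolding tournament_def pair_digraph_iff reverse_arcs_def pair_pre_digraph.simps
    using fin by blast
qed

lemma ex_non_simple_reversal:
  assumes "tournament T" "card (pverts T) \<ge> 3"
  shows "\<exists>B. B \<subseteq> parcs T \<and> tournament (reverse_arcs T B) \<and>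
           \<not> simple_tournament (reverse_arcs T B)"
proof -
  have fin: "finite (pverts T)" using assms(1) unfolding tournament_def pair_digraph_iff by blast
  obtain v where v: "v \<in> pverts T" using assms(2) by fastforce
  define B where "B = {(x, y) \<in> parcs T. y = v}"
  let ?M = "pverts T - {v}"
  have B: "B \<subseteq> parcs T" by (auto simp: B_def)
  have "(v, m) \<in> parcs (reverse_arcs T B)" if "m \<in> ?M" for m
  proof -
    from that have "m \<in> pverts T" "v \<noteq> m" by auto
    then have "(v, m) \<in> parcs T \<longleftrightarrow> (m, v) \<notin> parcs T"
      using v assms(1) unfolding tournament_def by blast
    then show ?thesis
      using \<open>v \<noteq> m\<close> unfolding reverse_arcs_def B_def pair_pre_digraph.simps by blast
  qed
  then have m: "is_module (reverse_arcs T B) ?M"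
    by (auto simp: is_module_def reverse_arcs_def)
  have c: "card ?M \<ge> 2" using fin v assms(2) by simp
  have "?M \<noteq> {}" using c by fastforce
  moreover have "?M \<noteq> {x}" for x
  proof
    assume "?M = {x}"
    then have "card ?M = 1" by (metis is_singletonI is_singleton_altdef)
    with c show False by linarith
  qed
  moreover have "?M \<noteq> pverts T" using v by blast
  ultimately have "\<not> trivial_module (reverse_arcs T B) ?M"
    unfolding trivial_module_def reverse_arcs_def pair_pre_digraph.simps by blast
  with m have "\<not> simple_tournament (reverse_arcs T B)"
    unfolding simple_tournament_def by blast
  with B tournament_reverse_arcs[OF assms(1) B] show ?thesis by blast
qed

end

theory Submission
  imports Defs
begin

text \<open>
  Reversing all arcs leaving (or entering) a vertex \<open>x\<close> makes \<open>V - {x}\<close> a module, and reversing the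
  arcs between \<open>x\<close> and the vertices separating \<open>x\<close> from \<open>y\<close> makes \<open>{x, y}\<close> a module. So \<open>s(T)\<close> is
  at most every out- and in-degree and at most the number \<open>\<sigma>(x, y)\<close> of vertices separating any two
  vertices. Were the claimed bound false, the degrees would be as balanced as possible; double
  counting then gives the sum of all \<open>\<sigma>(x, y)\<close>, while \<open>\<sigma>(x, y)\<close> has the parity of
  \<open>d(x) + d(y) + 1\<close>, and this forces the sum of the \<open>\<sigma>(x, y)\<close> to be too large.
\<close>

section \<open>Neighbourhoods and separators in a tournament\<close>

definition out_nbs :: "'a pair_pre_digraph \<Rightarrow> 'a \<Rightarrow> 'a set" where
  "out_nbs T x = {y. (x, y) \<in> parcs T}"

definition in_nbs :: "'a pair_pre_digraph \<Rightarrow> 'a \<Rightarrow> 'a set" where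
  "in_nbs T x = {y. (y, x) \<in> parcs T}"

text \<open>In a tournament neither \<open>x\<close> nor \<open>y\<close> lies in this set, and it
  is empty for \<open>x = y\<close>, so sums over all ordered pairs need no exception on the
  diagonal.\<close>

definition separators :: "'a pair_pre_digraph \<Rightarrow> 'a \<Rightarrow> 'a \<Rightarrow> 'a set" where
  "separators T x y = out_nbs T x \<inter> in_nbs T y \<union> in_nbs T x \<inter> out_nbs T y"

lemma tournament_facts:
  assumes "tournament T"
  shows "finite (pverts T)" "parcs T \<subseteq> pverts T \<times> pverts T" "(x, x) \<notin> parcs T"
    "(x, y) \<in> parcs T \<Longrightarrow> (y, x) \<notin> parcs T"
    "\<lbrakk>x \<in> pverts T; y \<in> pverts T; x \<noteq> y\<rbrakk> \<Longrightarrow> (x, y) \<in> parcs T \<or> (y, x) \<in> parcs T"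
proof -
  show *: "finite (pverts T)" "parcs T \<subseteq> pverts T \<times> pverts T" "(x, x) \<notin> parcs T" for x
    using assms unfolding tournament_def pair_digraph_iff by blast+
  show "(x, y) \<in> parcs T \<Longrightarrow> (y, x) \<notin> parcs T"
    using * assms unfolding tournament_def by (cases "x = y") blast+
  show "\<lbrakk>x \<in> pverts T; y \<in> pverts T; x \<noteq> y\<rbrakk> \<Longrightarrow> (x, y) \<in> parcs T \<or> (y, x) \<in> parcs T"
    using assms unfolding tournament_def by blast
qed

lemma nbs_subset:
  assumes "tournament T"
  shows "out_nbs T x \<subseteq> pverts T" "in_nbs T x \<subseteq> pverts T"
  using tournament_facts(2)[OF assms] by (auto simp: out_nbs_def in_nbs_def)

lemma finite_nbs:
  assumes "tournament T"
  shows "finite (out_nbs T x)" "finite (in_nbs T x)"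
  by (rule finite_subset[OF nbs_subset(1)[OF assms] tournament_facts(1)[OF assms]],
      rule finite_subset[OF nbs_subset(2)[OF assms] tournament_facts(1)[OF assms]])

lemma card_out_plus_in:
  assumes "tournament T" "x \<in> pverts T"
  shows "card (out_nbs T x) + card (in_nbs T x) + 1 = card (pverts T)"
proof -
  note f = tournament_facts[OF assms(1)]
  have V: "pverts T = insert x (out_nbs T x \<union> in_nbs T x)"
    using f(2) f(5)[OF assms(2)] assms(2)
    by (auto simp: out_nbs_def in_nbs_def)
  have "out_nbs T x \<inter> in_nbs T x = {}" "x \<notin> out_nbs T x \<union> in_nbs T x"
    using f(3,4) by (auto simp: out_nbs_def in_nbs_def)
  then show ?thesis
    using finite_nbs[OF assms(1)] by (subst V) (simp add: card_Un_disjoint)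
qed

section \<open>Upper bounds from modules created by reversals\<close>

lemma simplicity_index_le:
  assumes "tournament T" "B \<subseteq> parcs T" "is_module (reverse_arcs T B) M"
    and "card M \<ge> 2" "M \<noteq> pverts T"
  shows "simplicity_index T \<le> card B"
proof -
  have "\<not> trivial_module (reverse_arcs T B) M"
    using assms(4,5) unfolding trivial_module_def reverse_arcs_def pair_pre_digraph.simps by auto
  then have "\<not> simple_tournament (reverse_arcs T B)"
    using assms(3) unfolding simple_tournament_def by blast
  then show ?thesis
    unfolding simplicity_index_def
    using assms(2) tournament_reverse_arcs[OF assms(1,2)] by (intro Least_le) blast
qed

lemma simplicity_index_le_degree:
  assumes "tournament T" "card (pverts T) \<ge> 3" "x \<in> pverts T"
  shows "simplicity_index T \<le> card (out_nbs T x)" "simplicity_index T \<le> card (in_nbs T x)"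
proof -
  note f = tournament_facts[OF assms(1)]
  let ?M = "pverts T - {x}"
  have M: "card ?M \<ge> 2" "?M \<noteq> pverts T"
    using assms f(1) by auto
  have "simplicity_index T \<le> card (Pair x ` out_nbs T x)"
  proof (rule simplicity_index_le[OF assms(1) _ _ M])
    show "is_module (reverse_arcs T (Pair x ` out_nbs T x)) ?M"
      using f(5)[OF assms(3)] by (auto simp: is_module_def reverse_arcs_def out_nbs_def)
  qed (auto simp: out_nbs_def)
  also have "\<dots> \<le> card (out_nbs T x)"
    by (rule card_image_le[OF finite_nbs(1)[OF assms(1)]])
  finally show "simplicity_index T \<le> card (out_nbs T x)" .
  have "simplicity_index T \<le> card ((\<lambda>y. (y, x)) ` in_nbs T x)"
  proof (rule simplicity_index_le[OF assms(1) _ _ M])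
    show "is_module (reverse_arcs T ((\<lambda>y. (y, x)) ` in_nbs T x)) ?M"
      using f(5)[OF assms(3)] by (auto simp: is_module_def reverse_arcs_def in_nbs_def)
  qed (auto simp: in_nbs_def)
  also have "\<dots> \<le> card (in_nbs T x)"
    by (rule card_image_le[OF finite_nbs(2)[OF assms(1)]])
  finally show "simplicity_index T \<le> card (in_nbs T x)" .
qed

lemma finite_separators: "tournament T \<Longrightarrow> finite (separators T x y)"
  by (simp add: separators_def finite_nbs)

lemma simplicity_index_le_separators:
  assumes "tournament T" "card (pverts T) \<ge> 3" "x \<in> pverts T" "y \<in> pverts T" "x \<noteq> y"
  shows "simplicity_index T \<le> card (separators T x y)"
proof -
  note f = tournament_facts[OF assms(1)]
  let ?S = "separators T x y"
  \<comment> \<open>Only arcs at \<open>x\<close> are reversed: on each separator \<open>x\<close>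
    is made to agree with \<open>y\<close>, while \<open>x\<close> and \<open>y\<close> already
    agree on every other vertex.\<close>
  define B where "B = {(u, v) \<in> parcs T. u = x \<and> v \<in> ?S \<or> v = x \<and> u \<in> ?S}"
  have B: "B \<subseteq> parcs T" by (auto simp: B_def)
  have S: "z \<in> ?S \<longleftrightarrow>
      (x, z) \<in> parcs T \<and> (z, y) \<in> parcs T \<or> (z, x) \<in> parcs T \<and> (y, z) \<in> parcs T" for z
    by (auto simp: separators_def out_nbs_def in_nbs_def)
  have inB: "(x, z) \<in> B \<longleftrightarrow> (x, z) \<in> parcs T \<and> (z, y) \<in> parcs T"
    "(z, x) \<in> B \<longleftrightarrow> (z, x) \<in> parcs T \<and> (y, z) \<in> parcs T"
    "(z, y) \<notin> B" "(y, z) \<notin> B" if "z \<noteq> x" for z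
  proof -
    have "\<not> ((x, z) \<in> parcs T \<and> (z, x) \<in> parcs T)" using f(4) by blast
    then show "(x, z) \<in> B \<longleftrightarrow> (x, z) \<in> parcs T \<and> (z, y) \<in> parcs T"
      "(z, x) \<in> B \<longleftrightarrow> (z, x) \<in> parcs T \<and> (y, z) \<in> parcs T"
      "(z, y) \<notin> B" "(y, z) \<notin> B"
      unfolding B_def using that assms(5) S[of z] by blast+
  qed
  have "is_module (reverse_arcs T B) {x, y}"
    unfolding is_module_def
  proof (intro conjI ballI)
    fix z assume "z \<in> pverts (reverse_arcs T B) - {x, y}"
    then have z: "z \<in> pverts T" "z \<noteq> x" "z \<noteq> y" by (auto simp: reverse_arcs_def)
    show "(\<forall>m\<in>{x, y}. (m, z) \<in> parcs (reverse_arcs T B)) \<or>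
      (\<forall>m\<in>{x, y}. (z, m) \<in> parcs (reverse_arcs T B))"
    proof -
      have "(x, z) \<in> parcs T \<longleftrightarrow> (z, x) \<notin> parcs T" "(y, z) \<in> parcs T \<longleftrightarrow> (z, y) \<notin> parcs T"
        using f(4,5) assms(3,4) z by metis+
      then show ?thesis
        unfolding reverse_arcs_def using inB[OF z(2)] by simp blast
    qed
  qed (use assms in \<open>auto simp: reverse_arcs_def\<close>)
  moreover have "card {x, y} = 2" using assms(5) by simp
  moreover from this have "{x, y} \<noteq> pverts T" using assms(2) by auto
  ultimately have "simplicity_index T \<le> card B"
    using simplicity_index_le[OF assms(1) B] by simp
  also have "\<dots> \<le> card ?S"
  proof (rule surj_card_le[OF finite_separators[OF assms(1)]])
    \<comment> \<open>Each separator contributes only one arc, namely the one joining it to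
      \<open>x\<close> in whichever direction \<open>T\<close> has it.\<close>
    show "B \<subseteq> (\<lambda>z. if (x, z) \<in> parcs T then (x, z) else (z, x)) ` ?S"
    proof
      fix e assume "e \<in> B"
      then obtain z where z: "z \<in> ?S" "e \<in> parcs T" "e = (x, z) \<or> e = (z, x)"
        unfolding B_def by blast
      then have "e = (if (x, z) \<in> parcs T then (x, z) else (z, x))"
        using f(4)[of z x] by (elim disjE) simp_all
      with z(1) show "e \<in> (\<lambda>z. if (x, z) \<in> parcs T then (x, z) else (z, x)) ` ?S"
        by (intro image_eqI)
    qed
  qed
  finally show ?thesis .
qed

section \<open>Parity of the number of separators\<close>

lemma separators_commute: "separators T x y = separators T y x"
  by (auto simp: separators_def)

text \<open>The out-neighbours of \<open>x\<close> are \<open>y\<close>, the common out-neighbours,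
  and the separators of one kind; those of \<open>y\<close> are the common ones and the separators
  of the other kind. The summand 1 is \<open>y\<close> itself.\<close>

lemma card_separators_arc:
  assumes "tournament T" "(x, y) \<in> parcs T"
  shows "card (separators T x y) + 1 + 2 * card (out_nbs T x \<inter> out_nbs T y)
    = card (out_nbs T x) + card (out_nbs T y)"
proof -
  note f = tournament_facts[OF assms(1)] and fin = finite_nbs[OF assms(1)]
  have V: "x \<in> pverts T" "y \<in> pverts T" using f(2) assms(2) by auto
  let ?a = "out_nbs T x \<inter> out_nbs T y" and ?b = "out_nbs T x \<inter> in_nbs T y"
    and ?c = "in_nbs T x \<inter> out_nbs T y"
  have disj: "?a \<inter> ?b = {}" "?a \<inter> ?c = {}" "?b \<inter> ?c = {}" "y \<notin> ?a \<union> ?b"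
    using f(3,4) by (auto simp: out_nbs_def in_nbs_def)
  have "out_nbs T x = insert y (?a \<union> ?b)"
    using f(2) f(5)[OF _ V(2)] assms(2) by (auto simp: out_nbs_def in_nbs_def)
  then have "card (out_nbs T x) = card (insert y (?a \<union> ?b))" by simp
  then have x: "card (out_nbs T x) = 1 + card ?a + card ?b"
    using disj fin by (simp add: card_Un_disjoint)
  have "out_nbs T y = ?a \<union> ?c"
    using f(2,4) f(5)[OF _ V(1)] assms(2) by (auto simp: out_nbs_def in_nbs_def)
  then have "card (out_nbs T y) = card (?a \<union> ?c)" by simp
  then have y: "card (out_nbs T y) = card ?a + card ?c"
    using disj fin by (simp add: card_Un_disjoint)
  have "card (separators T x y) = card ?b + card ?c"
    unfolding separators_def using disj fin by (simp add: card_Un_disjoint)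
  with x y show ?thesis by simp
qed

text \<open>This is the preceding count read modulo 2. The claim is symmetric in the two vertices,
  so the direction of the arc between them does not matter.\<close>

lemma even_card_separators:
  assumes "tournament T" "x \<in> pverts T" "y \<in> pverts T" "x \<noteq> y"
  shows "even (card (separators T x y)) \<longleftrightarrow> odd (card (out_nbs T x) + card (out_nbs T y))"
proof -
  have *: "even (card (separators T u v)) \<longleftrightarrow> odd (card (out_nbs T u) + card (out_nbs T v))"
    if "(u, v) \<in> parcs T" for u v
    unfolding card_separators_arc[OF assms(1) that, symmetric] by simp
  show ?thesis
    using tournament_facts(5)[OF assms] *[of x y] *[of y x]
    by (auto simp: separators_commute add.commute)
qed

section \<open>Double counting\<close>

lemma card_eq_sum_of_bool:
  assumes "finite V" "S \<subseteq> V"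
  shows "card S = (\<Sum>z\<in>V. of_bool (z \<in> S))"
  using assms by (simp add: Int_absorb1)

text \<open>Both sides count the directed paths from \<open>x\<close> through \<open>z\<close> to
  \<open>y\<close>: on the left by their two ends, on the right by their middle vertex.\<close>

lemma sum_card_out_Int_in:
  assumes "tournament T"
  shows "(\<Sum>x\<in>pverts T. \<Sum>y\<in>pverts T. card (out_nbs T x \<inter> in_nbs T y))
    = (\<Sum>z\<in>pverts T. card (in_nbs T z) * card (out_nbs T z))"
proof -
  let ?V = "pverts T"
  note V = tournament_facts(1)[OF assms] and sub = nbs_subset[OF assms]
  have "card (out_nbs T x \<inter> in_nbs T y)
    = (\<Sum>z\<in>?V. of_bool (x \<in> in_nbs T z) * of_bool (y \<in> out_nbs T z))" for x y
    by (subst card_eq_sum_of_bool[OF V])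
      (use sub in \<open>auto simp: out_nbs_def in_nbs_def intro!: sum.cong\<close>)
  then have "(\<Sum>x\<in>?V. \<Sum>y\<in>?V. card (out_nbs T x \<inter> in_nbs T y))
    = (\<Sum>x\<in>?V. \<Sum>y\<in>?V. \<Sum>z\<in>?V. of_bool (x \<in> in_nbs T z) * of_bool (y \<in> out_nbs T z))"
    by simp
  also have "\<dots> = (\<Sum>x\<in>?V. \<Sum>z\<in>?V. \<Sum>y\<in>?V. of_bool (x \<in> in_nbs T z) * of_bool (y \<in> out_nbs T z))"
    by (intro sum.cong refl sum.swap)
  also have "\<dots> = (\<Sum>z\<in>?V. \<Sum>x\<in>?V. \<Sum>y\<in>?V. of_bool (x \<in> in_nbs T z) * of_bool (y \<in> out_nbs T z))"
    by (rule sum.swap)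
  also have "\<dots> = (\<Sum>z\<in>?V. card (in_nbs T z) * card (out_nbs T z))"
    unfolding card_eq_sum_of_bool[OF V sub(1)] card_eq_sum_of_bool[OF V sub(2)] sum_product ..
  finally show ?thesis .
qed

text \<open>A separator of \<open>x\<close> and \<open>y\<close> is the middle of a path from
  \<open>x\<close> to \<open>y\<close> or from \<open>y\<close> to \<open>x\<close>, never both.
  Over ordered pairs each path is thus counted twice.\<close>

lemma sum_card_separators:
  assumes "tournament T"
  shows "(\<Sum>x\<in>pverts T. \<Sum>y\<in>pverts T. card (separators T x y))
    = 2 * (\<Sum>z\<in>pverts T. card (in_nbs T z) * card (out_nbs T z))"
proof -
  let ?V = "pverts T"
  have "card (separators T x y) = card (out_nbs T x \<inter> in_nbs T y) + card (out_nbs T y \<inter> in_nbs T x)"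
    for x y
  proof -
    have "(out_nbs T x \<inter> in_nbs T y) \<inter> (in_nbs T x \<inter> out_nbs T y) = {}"
      using tournament_facts(4)[OF assms] by (auto simp: out_nbs_def in_nbs_def)
    then show ?thesis
      unfolding separators_def using finite_nbs[OF assms]
      by (simp add: card_Un_disjoint Int_commute)
  qed
  then have "(\<Sum>x\<in>?V. \<Sum>y\<in>?V. card (separators T x y))
    = (\<Sum>x\<in>?V. \<Sum>y\<in>?V. card (out_nbs T x \<inter> in_nbs T y))
      + (\<Sum>x\<in>?V. \<Sum>y\<in>?V. card (out_nbs T y \<inter> in_nbs T x))"
    by (simp add: sum.distrib)
  also have "(\<Sum>x\<in>?V. \<Sum>y\<in>?V. card (out_nbs T y \<inter> in_nbs T x))
    = (\<Sum>x\<in>?V. \<Sum>y\<in>?V. card (out_nbs T x \<inter> in_nbs T y))"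
    by (rule sum.swap)
  finally show ?thesis
    by (simp add: sum_card_out_Int_in[OF assms])
qed

text \<open>Both sides count all arcs, by tail and by head.\<close>

lemma sum_card_out_eq_in:
  assumes "tournament T"
  shows "(\<Sum>x\<in>pverts T. card (out_nbs T x)) = (\<Sum>x\<in>pverts T. card (in_nbs T x))"
proof -
  note V = tournament_facts(1)[OF assms] and sub = nbs_subset[OF assms]
  have "(\<Sum>x\<in>pverts T. card (out_nbs T x))
    = (\<Sum>x\<in>pverts T. \<Sum>y\<in>pverts T. of_bool (y \<in> out_nbs T x))"
    by (simp only: card_eq_sum_of_bool[OF V sub(1)])
  also have "\<dots> = (\<Sum>y\<in>pverts T. \<Sum>x\<in>pverts T. of_bool (y \<in> out_nbs T x))"
    by (rule sum.swap)
  also have "\<dots> = (\<Sum>y\<in>pverts T. card (in_nbs T y))"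
    by (simp only: card_eq_sum_of_bool[OF V sub(2)]) (simp add: out_nbs_def in_nbs_def)
  finally show ?thesis .
qed

section \<open>The three residue classes\<close>

text \<open>The two degrees of a vertex sum to the odd number \<open>4 * k + 1\<close>, so the
  smaller one is at most \<open>2 * k\<close>.\<close>

lemma simplicity_index_4k_plus_2:
  assumes "tournament T" "card (pverts T) = 4 * k + 2" "k \<ge> 1"
  shows "simplicity_index T \<le> 2 * k"
proof -
  have c: "card (pverts T) \<ge> 3" using assms(2,3) by simp
  then obtain x where x: "x \<in> pverts T" by fastforce
  show ?thesis
    using simplicity_index_le_degree[OF assms(1) c x] card_out_plus_in[OF assms(1) x] assms(2)
    by linarith
qed

text \<open>A counterexample is regular of degree \<open>2 * k\<close>, so every \<sigma>(x, y) with
  distinct arguments is odd and hence at least \<open>2 * k + 1\<close>. Double counting gives them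
  the average \<open>2 * k\<close>.\<close>

lemma simplicity_index_4k_plus_1:
  assumes "tournament T" "card (pverts T) = 4 * k + 1" "k \<ge> 1"
  shows "simplicity_index T < 2 * k"
proof (rule ccontr)
  let ?V = "pverts T"
  assume "\<not> ?thesis"
  then have s: "2 * k \<le> simplicity_index T" by simp
  have c: "card ?V \<ge> 3" using assms(2,3) by simp
  note V = tournament_facts(1)[OF assms(1)]
  have deg: "card (out_nbs T x) = 2 * k \<and> card (in_nbs T x) = 2 * k" if "x \<in> ?V" for x
    using simplicity_index_le_degree[OF assms(1) c that] card_out_plus_in[OF assms(1) that]
      assms(2) s by linarith
  have sep: "card (separators T x y) \<ge> 2 * k + 1" if "x \<in> ?V" "y \<in> ?V - {x}" for x y
  proof -
    have "odd (card (separators T x y))"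
      using even_card_separators[OF assms(1), of x y] that deg by auto
    moreover have "card (separators T x y) \<ge> 2 * k"
      using simplicity_index_le_separators[OF assms(1) c, of x y] that s by auto
    ultimately show ?thesis by (cases "card (separators T x y) = 2 * k") auto
  qed
  have row: "(\<Sum>y\<in>?V. card (separators T x y)) \<ge> 4 * k * (2 * k + 1)" if x: "x \<in> ?V" for x
  proof -
    have "4 * k * (2 * k + 1) = (\<Sum>y\<in>?V - {x}. 2 * k + 1)"
      using x assms(2) V by simp
    also have "\<dots> \<le> (\<Sum>y\<in>?V - {x}. card (separators T x y))"
      by (rule sum_mono[OF sep[OF x]])
    also have "\<dots> \<le> (\<Sum>y\<in>?V. card (separators T x y))"
      by (rule sum_mono2) (use V in auto)
    finally show ?thesis .
  qed
  have "(4 * k + 1) * (4 * k * (2 * k + 1)) = (\<Sum>x\<in>?V. 4 * k * (2 * k + 1))"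
    using assms(2) by simp
  also have "\<dots> \<le> (\<Sum>x\<in>?V. \<Sum>y\<in>?V. card (separators T x y))"
    by (rule sum_mono[OF row])
  also have "\<dots> = 2 * (\<Sum>z\<in>?V. 2 * k * (2 * k))"
    unfolding sum_card_separators[OF assms(1)] using deg by simp
  also have "\<dots> = (4 * k + 1) * (4 * k * (2 * k))"
    using assms(2) by simp
  finally have "(4 * k + 1) * (4 * k * (2 * k + 1)) \<le> (4 * k + 1) * (4 * k * (2 * k))" .
  then show False using assms(3) unfolding mult_le_cancel1 by simp
qed

text \<open>In a counterexample the degrees of each vertex are \<open>2 * k\<close> and
  \<open>2 * k - 1\<close> in some order. Parity raises the lower bound on \<sigma>(x, y) by one for
  pairs with different out-degrees, which is just enough to exceed the double count.\<close>

lemma simplicity_index_4k: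
  assumes "tournament T" "card (pverts T) = 4 * k" "k \<ge> 1"
  shows "simplicity_index T + 1 < 2 * k"
proof (rule ccontr)
  let ?V = "pverts T"
  assume "\<not> ?thesis"
  then have s: "2 * k - 1 \<le> simplicity_index T" by simp
  have c: "card ?V \<ge> 3" using assms(2,3) by simp
  note V = tournament_facts(1)[OF assms(1)]
  have deg: "card (out_nbs T x) = 2 * k \<and> card (in_nbs T x) = 2 * k - 1 \<or>
    card (out_nbs T x) = 2 * k - 1 \<and> card (in_nbs T x) = 2 * k" if "x \<in> ?V" for x
    using simplicity_index_le_degree[OF assms(1) c that] card_out_plus_in[OF assms(1) that]
      assms(2,3) s by linarith
  define H where "H = {x \<in> ?V. card (out_nbs T x) = 2 * k}"
  define L where "L = {x \<in> ?V. card (out_nbs T x) = 2 * k - 1}"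
  have HL: "H \<union> L = ?V" "H \<inter> L = {}" "finite H" "finite L"
    using deg V assms(3) by (auto simp: H_def L_def)
  have HLcard: "card H = 2 * k \<and> card L = 2 * k"
  proof -
    have split: "(\<Sum>x\<in>?V. f x) = (\<Sum>x\<in>H. f x) + (\<Sum>x\<in>L. f x)" for f :: "'a \<Rightarrow> nat"
      using sum.union_disjoint[OF HL(3,4,2), of f] HL(1) by simp
    have H: "card (out_nbs T x) = 2 * k" "card (in_nbs T x) = 2 * k - 1" if "x \<in> H" for x
      using deg[of x] that assms(3) by (auto simp: H_def)
    have L: "card (out_nbs T x) = 2 * k - 1" "card (in_nbs T x) = 2 * k" if "x \<in> L" for x
      using deg[of x] that assms(3) by (auto simp: L_def)
    \<comment> \<open>Equality of the total out- and in-degree forces as many vertices of high as of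
      low out-degree.\<close>
    have "card H * (2 * k) + card L * (2 * k - 1) = card H * (2 * k - 1) + card L * (2 * k)"
      using sum_card_out_eq_in[OF assms(1)] unfolding split by (simp add: H L)
    \<comment> \<open>Writing \<open>2 * k\<close> as a successor removes the truncated subtraction;
      cancellation then leaves \<open>card H = card L\<close>.\<close>
    moreover obtain j where "2 * k = Suc j" using assms(3) by (cases "2 * k") auto
    ultimately have "card H = card L" by simp
    moreover have "card H + card L = 4 * k"
      using card_Un_disjoint[OF HL(3,4,2)] HL(1) assms(2) by simp
    ultimately show ?thesis by simp
  qed
  \<comment> \<open>For a pair across the two classes the out-degrees sum to
    \<open>4 * k - 1\<close>, so \<sigma>(x, y) is even and cannot equal the odd number
    \<open>2 * k - 1\<close>.\<close>
  have sep: "card (separators T x y) \<ge> 2 * k - 1 + of_bool ((x \<in> H) \<noteq> (y \<in> H))"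
    if "x \<in> ?V" "y \<in> ?V - {x}" for x y
  proof -
    have ge: "card (separators T x y) \<ge> 2 * k - 1"
      using simplicity_index_le_separators[OF assms(1) c, of x y] that s by auto
    have "card (separators T x y) \<noteq> 2 * k - 1" if ne: "(x \<in> H) \<noteq> (y \<in> H)"
    proof -
      have "even (card (separators T x y))"
        using even_card_separators[OF assms(1), of x y] that(1) \<open>x \<in> ?V\<close> \<open>y \<in> ?V - {x}\<close>
          ne deg[of x] deg[of y] assms(3) by (auto simp: H_def)
      moreover have "odd (2 * k - 1)" using assms(3) by simp
      ultimately show ?thesis by metis
    qed
    with ge show ?thesis by (cases "(x \<in> H) = (y \<in> H)") auto
  qed
  have row: "(\<Sum>y\<in>?V. card (separators T x y)) \<ge> (4 * k - 1) * (2 * k - 1) + 2 * k"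
    if x: "x \<in> ?V" for x
  proof -
    \<comment> \<open>The class opposite to \<open>x\<close> does not contain \<open>x\<close>, so
      all of its \<open>2 * k\<close> members gain the extra one in this row.\<close>
    have "(if x \<in> H then L else H) = (?V - {x}) \<inter> {y. (x \<in> H) \<noteq> (y \<in> H)}"
      using HL(1,2) x by auto
    then have "card ((?V - {x}) \<inter> {y. (x \<in> H) \<noteq> (y \<in> H)}) = 2 * k"
      using HLcard by (metis (mono_tags, lifting))
    then have "(\<Sum>y\<in>?V - {x}. of_bool ((x \<in> H) \<noteq> (y \<in> H))) = 2 * k"
      using V by simp
    then have "(4 * k - 1) * (2 * k - 1) + 2 * k
      = (\<Sum>y\<in>?V - {x}. 2 * k - 1 + of_bool ((x \<in> H) \<noteq> (y \<in> H)))"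
      using x assms(2) V by (simp add: sum.distrib)
    also have "\<dots> \<le> (\<Sum>y\<in>?V - {x}. card (separators T x y))"
      by (rule sum_mono[OF sep[OF x]])
    also have "\<dots> \<le> (\<Sum>y\<in>?V. card (separators T x y))"
      by (rule sum_mono2) (use V in auto)
    finally show ?thesis .
  qed
  have "4 * k * ((4 * k - 1) * (2 * k - 1) + 2 * k)
    = (\<Sum>x\<in>?V. (4 * k - 1) * (2 * k - 1) + 2 * k)"
    using assms(2) by simp
  also have "\<dots> \<le> (\<Sum>x\<in>?V. \<Sum>y\<in>?V. card (separators T x y))"
    by (rule sum_mono[OF row])
  \<comment> \<open>The product of the two degrees is the same in both classes.\<close>
  also have "\<dots> = 2 * (\<Sum>z\<in>?V. 2 * k * (2 * k - 1))"
    unfolding sum_card_separators[OF assms(1)]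
    by (intro arg_cong[of _ _ "(*) 2"] sum.cong refl) (use deg in fastforce)
  also have "\<dots> = 4 * k * (4 * k * (2 * k - 1))"
    using assms(2) by simp
  \<comment> \<open>The left side is in fact larger than the right by exactly one.\<close>
  finally have le: "(4 * k - 1) * (2 * k - 1) + 2 * k \<le> 4 * k * (2 * k - 1)"
    using assms(3) by simp
  obtain j where "k = Suc j" using assms(3) by (cases k) auto
  with le show False by (simp add: algebra_simps)
qed

theorem theorem1p1:
  fixes T :: "'a pair_pre_digraph" and n :: nat and k :: int
  assumes "tournament T" and "card (pverts T) = n" and "n \<ge> 3"
  shows "(int n = 4 * k + 2 \<longrightarrow> int (simplicity_index T) \<le> 2 * k) \<and>
         (int n = 4 * k + 1 \<longrightarrow> int (simplicity_index T) \<le> 2 * k - 1) \<and>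
         (int n = 4 * k \<longrightarrow> int (simplicity_index T) \<le> 2 * k - 2)"
proof (intro conjI impI)
  \<comment> \<open>In each case \<open>n \<ge> 3\<close> forces \<open>k \<ge> 1\<close>, so
    passing to \<open>nat k\<close> loses nothing.\<close>
  define m where "m = nat k"
  {
    assume *: "int n = 4 * k + 2"
    then have "k = int m" "n = 4 * m + 2" "m \<ge> 1" using assms(3) by (auto simp: m_def)
    then show "int (simplicity_index T) \<le> 2 * k"
      using simplicity_index_4k_plus_2[of T m] assms by simp
  next
    assume *: "int n = 4 * k + 1"
    then have "k = int m" "n = 4 * m + 1" "m \<ge> 1" using assms(3) by (auto simp: m_def)
    then show "int (simplicity_index T) \<le> 2 * k - 1"
      using simplicity_index_4k_plus_1[of T m] assms by simp
  next
    assume *: "int n = 4 * k"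
    then have "k = int m" "n = 4 * m" "m \<ge> 1" using assms(3) by (auto simp: m_def)
    then show "int (simplicity_index T) \<le> 2 * k - 2"
      using simplicity_index_4k[of T m] assms by simp
  }
qed

end
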